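(* For every integer $k>1$, \[k2^{k-1}\log 2 + (-1)^{k+1} k!\,C_k\, 2^{k-1} + \sum_{j=1}^{k} C_j (-1)^j\frac{k!}{(k-j)!} = k2^{k-1}\log 2 - k\sum_{i=1}^{k-1}\frac{2^{k-1-i}}{i}.\]
   Context: $\log$ denotes the natural logarithm. Let $H_0=0$ and $H_\ell=\sum_{i=1}^{\ell}\frac{1}{i}$ for $\ell\ge 1$. For every integer $j\geq 1$, define $C_j=\frac{(-1)^j}{(j-1)!}H_{j-1}$. *)

theory Defs
  imports Complex_Main "HOL-Analysis.Harmonic_Numbers"
begin

(* Meant for j >= 1; at j = 0 the truncated j - 1 gives 0. *)
definition C :: "nat \<Rightarrow> real" where
  "C j = (-1) ^ j / fact (j - 1) * harm (j - 1)"

end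

theory Submission imports Defs begin

text \<open>
  With \<open>n = k - 1\<close> the identity reduces, after dividing by \<open>k\<close>, to
  \<open>(\<Sum>m\<le>n. (n choose m) * H\<^sub>m) = 2^n * H\<^sub>n - (\<Sum>i=1..n. 2^(n-i) / i)\<close>. By Pascal's rule
  the left-hand side \<open>S\<^sub>n\<close> satisfies \<open>S\<^sub>n\<^sub>+\<^sub>1 = 2 * S\<^sub>n + (2^(n+1) - 1) / (n+1)\<close>, and so does
  the right-hand side.
\<close>

text \<open>Absorption turns each summand into \<open>(Suc n choose Suc m) / Suc n\<close>; row
  \<open>Suc n\<close> sums to \<open>2 ^ Suc n\<close>, and its missing entry at index 0 accounts
  for the \<open>- 1\<close>.\<close>

lemma sum_binomial_over_Suc:
  "(\<Sum>m\<le>n. real (n choose m) / real (Suc m)) = (2 ^ Suc n - 1) / real (Suc n)"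
proof -
  have "real (n choose m) / real (Suc m) = real (Suc n choose Suc m) / real (Suc n)" for m
  proof -
    have "real (Suc m) * real (Suc n choose Suc m) = real (Suc n) * real (n choose m)"
      using Suc_times_binomial[of m n] by (metis of_nat_mult)
    then show ?thesis
      by (simp add: divide_simps mult.commute del: binomial_Suc_Suc of_nat_Suc)
  qed
  then have "(\<Sum>m\<le>n. real (n choose m) / real (Suc m))
      = (\<Sum>m\<le>n. real (Suc n choose Suc m)) / real (Suc n)"
    by (simp only: sum_divide_distrib)
  moreover have "(\<Sum>m\<le>Suc n. real (Suc n choose m)) = 2 ^ Suc n"
    using choose_row_sum[of "Suc n"] by (metis of_nat_sum of_nat_power of_nat_numeral)
  then have "(\<Sum>m\<le>n. real (Suc n choose Suc m)) = 2 ^ Suc n - 1"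
    by (subst (asm) sum.atMost_Suc_shift) simp
  ultimately show ?thesis by simp
qed

text \<open>Pascal's rule against an arbitrary weight; for \<open>f = harm\<close> the bracket is
  \<open>2 * harm m + 1 / Suc m\<close>.\<close>

lemma sum_binomial_mult_Suc:
  fixes f :: "nat \<Rightarrow> real"
  shows "(\<Sum>m\<le>Suc n. real (Suc n choose m) * f m) = (\<Sum>m\<le>n. real (n choose m) * (f m + f (Suc m)))"
proof -
  have "(\<Sum>m\<le>Suc n. real (Suc n choose m) * f m)
      = f 0 + (\<Sum>m\<le>n. real (n choose Suc m) * f (Suc m)) + (\<Sum>m\<le>n. real (n choose m) * f (Suc m))"
    by (subst sum.atMost_Suc_shift) (simp add: algebra_simps sum.distrib)
  \<comment> \<open>The top term \<open>m = Suc n\<close> on the right vanishes, since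
    \<open>n choose Suc n = 0\<close>.\<close>
  also have "f 0 + (\<Sum>m\<le>n. real (n choose Suc m) * f (Suc m)) = (\<Sum>m\<le>Suc n. real (n choose m) * f m)"
    by (subst sum.atMost_Suc_shift) simp
  finally show ?thesis
    by (simp add: algebra_simps sum.distrib)
qed

lemma sum_binomial_harm:
  "(\<Sum>m\<le>n. real (n choose m) * harm m) = 2 ^ n * harm n - (\<Sum>i=1..n. 2 ^ (n - i) / real i)"
proof (induction n)
  case 0
  then show ?case by (simp add: harm_def)
next
  case (Suc n)
  have "(\<Sum>m\<le>Suc n. real (Suc n choose m) * harm m)
      = 2 * (\<Sum>m\<le>n. real (n choose m) * harm m) + (\<Sum>m\<le>n. real (n choose m) / real (Suc m))"
    unfolding sum_binomial_mult_Suc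
    by (simp add: harm_Suc algebra_simps sum.distrib sum_distrib_left divide_inverse)
  \<comment> \<open>The omitted term \<open>i = Suc n\<close> is \<open>1 / Suc n\<close>; with the
    \<open>2 ^ Suc n / Suc n\<close> from \<open>harm_Suc\<close> it matches the inhomogeneous term
    of the recurrence.\<close>
  moreover have "(\<Sum>i=1..n. 2 ^ (Suc n - i) / real i) = 2 * (\<Sum>i=1..n. 2 ^ (n - i) / real i)"
    by (auto simp: sum_distrib_left Suc_diff_le intro!: sum.cong)
  ultimately show ?case
    unfolding sum_binomial_over_Suc Suc.IH
    by (simp add: harm_Suc algebra_simps divide_inverse)
qed

theorem theorem2p12:
  fixes k :: nat
  assumes "k > 1"
  shows "real k * 2 ^ (k - 1) * ln 2 + (-1) ^ (k + 1) * fact k * C k * 2 ^ (k - 1)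
           + (\<Sum>j = 1..k. C j * (-1) ^ j * (fact k / fact (k - j)))
         = real k * 2 ^ (k - 1) * ln 2
           - real k * (\<Sum>i = 1..k - 1. 2 ^ (k - 1 - i) / real i)"
proof -
  obtain n where k: "k = Suc n"
    using assms by (cases k) auto
  have sign: "(-1) ^ m * (-1) ^ m = (1::real)" for m :: nat
    by (simp flip: power_mult_distrib)
  \<comment> \<open>Times \<open>2 ^ n\<close>, this cancels the \<open>k * 2 ^ n * harm n\<close>
    that \<open>sum_binomial_harm\<close> contributes.\<close>
  have second: "(-1) ^ (k + 1) * fact k * C k = - real k * harm n"
    by (cases "even n") (simp_all add: C_def k algebra_simps)
  \<comment> \<open>With \<open>j = Suc m\<close> the two signs cancel, and
    \<open>k! / (m! * (n - m)!) = k * (n choose m)\<close>.\<close>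
  have "C (Suc m) * (-1) ^ Suc m * (fact k / fact (k - Suc m))
      = real k * (real (n choose m) * harm m)" if "m \<le> n" for m
  proof -
    have "C (Suc m) * (-1) ^ Suc m * (fact k / fact (k - Suc m))
        = ((-1) ^ Suc m * (-1) ^ Suc m) * harm m * (fact k / (fact m * fact (n - m)))"
      by (simp add: C_def k)
    also have "\<dots> = real k * (real (n choose m) * harm m)"
      unfolding sign using binomial_fact[OF that, where 'a = real] by (simp add: k)
    finally show ?thesis .
  qed
  then have "(\<Sum>j = 1..k. C j * (-1) ^ j * (fact k / fact (k - j)))
      = real k * (\<Sum>m\<le>n. real (n choose m) * harm m)"
    unfolding k One_nat_def sum.shift_bounds_cl_Suc_ivl sum_distrib_left atMost_atLeast0
    by (intro sum.cong) auto
  then show ?thesis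
    unfolding second sum_binomial_harm by (simp add: k algebra_simps)
qed

end
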